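(* Let $1\le s\le n$ be integers. Then the number of $[s]$-restricted parking functions on $n$ cars is $$\#\mathrm{PF}_{n\mid[s]}=\sum_{i=s}^{n}\binom{n}{i}(i+1)^{i-1}(s-i-1)^{n-i}.$$
   Context: $[m]=\{1,\dots,m\}$. A parking function on $n$ cars is a function $\pi:[n]\to[n]$ such that $\#\pi^{-1}([i])\ge i$ for every $i\in[n]$. For $S\subseteq[n]$, $\mathrm{PF}_{n\mid S}$ is the set of $S$-restricted parking functions on $n$ cars: parking functions on $n$ cars with image contained in $S$. The bases $s-i-1$ are negative integers, so the sum is an alternating sum of integers. *)

theory Defs
  imports "HOL-Library.FuncSet"
begin

(* The set of all functions [n] -> [n] is the extensional function space on {1..n},
   so that distinct HOL functions in it are distinct as maps on {1..n}. *)
definition parking_function :: "nat \<Rightarrow> (nat \<Rightarrow> nat) \<Rightarrow> bool" where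
  "parking_function n \<pi> \<longleftrightarrow>
     \<pi> \<in> {1..n} \<rightarrow>\<^sub>E {1..n} \<and>
     (\<forall>i\<in>{1..n}. card (\<pi> -` {1..i} \<inter> {1..n}) \<ge> i)"

definition restricted_PF :: "nat \<Rightarrow> nat set \<Rightarrow> (nat \<Rightarrow> nat) set" where
  "restricted_PF n S = {\<pi>. parking_function n \<pi> \<and> \<pi> ` {1..n} \<subseteq> S}"

end

theory Submission
  imports Defs
begin

text \<open>
  Let a map from \<open>n\<close> cars to the spots \<open>1, \<dots>, s\<close> fail to park, and let \<open>i + 1\<close> be the first spot
  that stays empty. The \<open>i\<close> cars preferring a spot up to \<open>i + 1\<close> then form a parking function, while
  the other \<open>n - i\<close> cars choose freely among the last \<open>s - i - 1\<close> spots. Writing \<open>P i\<close> for the number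
  of parking functions on \<open>i\<close> cars, the number of failing maps is therefore the sum over \<open>i < s\<close> of
  \<open>(n choose i) * P i * (s - i - 1) ^ (n - i)\<close>. For \<open>s = n + 1\<close> every map fails, and comparison with
  Abel's identity gives \<open>P i = (i + 1) ^ (i - 1)\<close> by induction. For \<open>s \<le> n\<close> Abel's identity says
  that the same sum over all \<open>i \<le> n\<close> equals \<open>s ^ n\<close>, so the successful maps account for the terms
  with \<open>i \<ge> s\<close>.
\<close>

section \<open>Abel's identity\<close>

text \<open>Up to sign this is the \<open>n\<close>-th finite difference of a polynomial of degree
  \<open>m < n\<close>. In the induction one factor \<open>x + i\<close> is split: the part with
  \<open>x\<close> is the induction hypothesis for the same \<open>n\<close>, and in the other part
  \<open>i\<close> is absorbed into the binomial coefficient, which lowers \<open>n\<close> by one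
  and moves \<open>x\<close> to \<open>x + 1\<close>.\<close>

lemma alternating_binomial_power_sum:
  fixes x :: "'a::comm_ring_1"
  assumes "m < n"
  shows "(\<Sum>i\<le>n. (- 1) ^ i * of_nat (n choose i) * (x + of_nat i) ^ m) = 0"
  using assms
proof (induction m arbitrary: n x)
  case 0
  then show ?case
    using choose_alternating_sum[of n, where 'a='a] by simp
next
  case (Suc m)
  then obtain k where n: "n = Suc k" and k: "m < k"
    by (cases n) auto
  have step: "(- 1) ^ Suc i * of_nat (n choose Suc i) * (of_nat (Suc i) * (x + of_nat (Suc i)) ^ m)
      = - of_nat n * ((- 1) ^ i * of_nat (k choose i) * (x + 1 + of_nat i) ^ m)" for i
  proof -
    have "of_nat (n choose Suc i) * of_nat (Suc i) = (of_nat n * of_nat (k choose i) :: 'a)"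
      unfolding n of_nat_mult[symmetric] using Suc_times_binomial_eq[of k i] by simp
    then have "of_nat (n choose Suc i) * (of_nat (Suc i) * (x + of_nat (Suc i)) ^ m)
        = of_nat n * of_nat (k choose i) * (x + of_nat (Suc i)) ^ m"
      by (metis mult.assoc)
    then have "(- 1) ^ Suc i * (of_nat (n choose Suc i) * (of_nat (Suc i) * (x + of_nat (Suc i)) ^ m))
        = (- 1) ^ Suc i * (of_nat n * of_nat (k choose i) * (x + of_nat (Suc i)) ^ m)"
      by (rule arg_cong)
    then show ?thesis
      by (simp only: of_nat_Suc) (simp add: algebra_simps)
  qed
  have "(\<Sum>i\<le>n. (- 1) ^ i * of_nat (n choose i) * (x + of_nat i) ^ Suc m) =
      x * (\<Sum>i\<le>n. (- 1) ^ i * of_nat (n choose i) * (x + of_nat i) ^ m)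
      + (\<Sum>i\<le>n. (- 1) ^ i * of_nat (n choose i) * (of_nat i * (x + of_nat i) ^ m))"
    unfolding sum_distrib_left sum.distrib[symmetric]
    by (intro sum.cong refl) (simp add: algebra_simps)
  also have "(\<Sum>i\<le>n. (- 1) ^ i * of_nat (n choose i) * (x + of_nat i) ^ m) = 0"
    using Suc.IH[of n x] Suc.prems by simp
  \<comment> \<open>The term for \<open>i = 0\<close> carries the factor 0, so the index can be
    shifted by one.\<close>
  also have "(\<Sum>i\<le>n. (- 1) ^ i * of_nat (n choose i) * (of_nat i * (x + of_nat i) ^ m))
      = (\<Sum>i\<le>k. (- 1) ^ Suc i * of_nat (n choose Suc i) * (of_nat (Suc i) * (x + of_nat (Suc i)) ^ m))"
    unfolding n by (subst sum.atMost_Suc_shift) simp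
  also have "\<dots> = - of_nat n * (\<Sum>i\<le>k. (- 1) ^ i * of_nat (k choose i) * (x + 1 + of_nat i) ^ m)"
    unfolding step sum_distrib_left ..
  also have "(\<Sum>i\<le>k. (- 1) ^ i * of_nat (k choose i) * (x + 1 + of_nat i) ^ m) = 0"
    by (rule Suc.IH[OF k])
  finally show ?case by simp
qed

text \<open>Expand each power of \<open>x - (i + 1)\<close> in powers of \<open>x\<close> and
  exchange the sums. For \<open>k < n\<close> the coefficient of \<open>x ^ k\<close> is, up to a
  factor, a finite difference of order \<open>n - k\<close> of a polynomial of degree
  \<open>n - k - 1\<close>, hence zero; only \<open>x ^ n\<close> survives.\<close>

lemma Abel_identity:
  fixes x :: "'a::comm_ring_1"
  shows "(\<Sum>i\<le>n. of_nat (n choose i) * (of_nat i + 1) ^ (i - 1) * (x - of_nat i - 1) ^ (n - i)) = x ^ n"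
proof -
  \<comment> \<open>The contribution of index \<open>i\<close> to the power \<open>x ^ k\<close>,
    with the factors that do not depend on \<open>i\<close> in front.\<close>
  define c where "c k i = x ^ k * of_nat (n choose k) * (- 1) ^ (n - k) *
    ((- 1) ^ i * of_nat (n - k choose i) * (1 + of_nat i) ^ (n - k - 1))" for k i
  have expand: "of_nat (n choose i) * (of_nat i + 1) ^ (i - 1) * (x - of_nat i - 1) ^ (n - i)
      = (\<Sum>k | k \<in> {..n} \<and> i + k \<le> n. c k i)" if "i \<le> n" for i
  proof -
    have "of_nat (n choose i) * (of_nat i + 1) ^ (i - 1) * (of_nat (n - i choose k) * x ^ k *
        (- (of_nat i + 1)) ^ (n - i - k)) = c k i" if k: "i + k \<le> n" for k
    proof -
      have choose: "of_nat (n choose i) * of_nat (n - i choose k)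
          = (of_nat (n choose k) * of_nat (n - k choose i) :: 'a)"
      proof -
        have "(n choose i) * (n - i choose k) = (n choose k) * (n - k choose i)"
          using k choose_mult[of i "i + k" n] choose_mult[of k "i + k" n]
            binomial_symmetric[of i "i + k"] by simp
        then show ?thesis
          by (metis of_nat_mult)
      qed
      have sign: "(- 1) ^ (n - i - k) = (- 1) ^ (n - k) * ((- 1) ^ i :: 'a)"
      proof -
        have "n - k = n - i - k + i" using k by simp
        then have "(- 1) ^ (n - k) * (- 1) ^ i = (- 1) ^ (n - i - k) * ((- 1) ^ i * (- 1) ^ i :: 'a)"
          by (simp add: power_add mult.assoc)
        also have "(- 1) ^ i * (- 1) ^ i = (1 :: 'a)"
          by (simp flip: power_mult_distrib)
        finally show ?thesis by simp
      qed
      \<comment> \<open>Truncated subtraction does no harm at \<open>i = 0\<close>, since the base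
        is then 1.\<close>
      have exponent: "(of_nat i + 1) ^ (i - 1) * (of_nat i + 1) ^ (n - i - k)
          = ((1 + of_nat i) ^ (n - k - 1) :: 'a)"
      proof (cases i)
        case (Suc j)
        then have "i - 1 + (n - i - k) = n - k - 1" using k by simp
        then show ?thesis
          by (metis power_add add.commute)
      qed simp
      have "of_nat (n choose i) * (of_nat i + 1) ^ (i - 1) * (of_nat (n - i choose k) * x ^ k *
          (- (of_nat i + 1)) ^ (n - i - k))
        = x ^ k * (of_nat (n choose i) * of_nat (n - i choose k)) * (- 1) ^ (n - i - k) *
          ((of_nat i + 1) ^ (i - 1) * (of_nat i + 1) ^ (n - i - k))"
        by (subst power_minus) (simp only: ac_simps)
      then show ?thesis
        unfolding choose sign exponent c_def by (simp only: ac_simps)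
    qed
    moreover have "(x - of_nat i - 1) ^ (n - i)
        = (\<Sum>k\<le>n - i. of_nat (n - i choose k) * x ^ k * (- (of_nat i + 1)) ^ (n - i - k))"
      using binomial_ring[of x "- (of_nat i + 1)" "n - i"] by (simp add: algebra_simps)
    moreover have "{k. k \<in> {..n} \<and> i + k \<le> n} = {..n - i}"
      using \<open>i \<le> n\<close> by auto
    ultimately show ?thesis
      using \<open>i \<le> n\<close> by (auto simp: sum_distrib_left intro!: sum.cong)
  qed
  have inner: "(\<Sum>i | i \<in> {..n} \<and> i + k \<le> n. c k i) = (if k = n then x ^ n else 0)" if "k \<le> n" for k
  proof -
    have "{i. i \<in> {..n} \<and> i + k \<le> n} = {..n - k}"
      using that by auto
    then show ?thesis
      using that alternating_binomial_power_sum[of "n - k - 1" "n - k" "1 :: 'a"]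
      by (auto simp: c_def simp flip: sum_distrib_left)
  qed
  have "(\<Sum>i\<le>n. of_nat (n choose i) * (of_nat i + 1) ^ (i - 1) * (x - of_nat i - 1) ^ (n - i))
      = (\<Sum>i\<le>n. \<Sum>k | k \<in> {..n} \<and> i + k \<le> n. c k i)"
    using expand by (intro sum.cong) auto
  also have "\<dots> = (\<Sum>k\<le>n. \<Sum>i | i \<in> {..n} \<and> i + k \<le> n. c k i)"
    by (rule sum.swap_restrict) auto
  also have "\<dots> = (\<Sum>k\<le>n. if k = n then x ^ n else 0)"
    using inner by (intro sum.cong) auto
  finally show ?thesis by simp
qed

section \<open>Counting maps by their first empty spot\<close>

lemma sum_subsets_by_card:
  fixes g :: "nat \<Rightarrow> nat"
  assumes "finite A"
  shows "(\<Sum>B | B \<subseteq> A \<and> card B < s. g (card B)) = (\<Sum>i<s. (card A choose i) * g i)"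
proof -
  have fin: "finite {B. B \<subseteq> A \<and> card B < s}"
    using assms by simp
  have "(\<Sum>B | B \<subseteq> A \<and> card B < s. g (card B))
      = (\<Sum>i<s. \<Sum>B | B \<in> {B. B \<subseteq> A \<and> card B < s} \<and> card B = i. g (card B))"
    using fin by (intro sum.group[symmetric]) auto
  also have "\<dots> = (\<Sum>i<s. (card A choose i) * g i)"
  proof (intro sum.cong refl)
    fix i assume "i \<in> {..<s}"
    then have "{B. B \<in> {B. B \<subseteq> A \<and> card B < s} \<and> card B = i} = {B. B \<subseteq> A \<and> card B = i}"
      by auto
    then show "(\<Sum>B | B \<in> {B. B \<subseteq> A \<and> card B < s} \<and> card B = i. g (card B)) = (card A choose i) * g i"
      using n_subsets[OF assms, of i] by simp
  qed
  finally show ?thesis .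
qed

text \<open>The condition says that all spots up to \<open>s\<close> get filled. The cars form an
  arbitrary set so that a subset of the cars can be treated without renumbering, and
  \<open>s\<close> is independent of the number of cars.\<close>

definition parking_maps :: "'a set \<Rightarrow> nat \<Rightarrow> ('a \<Rightarrow> nat) set" where
  "parking_maps A s = {f \<in> A \<rightarrow>\<^sub>E {1..s}. \<forall>i\<in>{1..s}. i \<le> card {a \<in> A. f a \<le> i}}"

text \<open>The set \<^term>\<open>B\<close> collects the cars preferring a spot below the first spot
  \<^term>\<open>card B + 1\<close> that remains empty.\<close>

definition overflow_maps :: "'a set \<Rightarrow> nat \<Rightarrow> 'a set \<Rightarrow> ('a \<Rightarrow> nat) set" where
  "overflow_maps A s B = {f \<in> A \<rightarrow>\<^sub>E {1..s}.
     restrict f B \<in> parking_maps B (card B) \<and> f ` (A - B) \<subseteq> {card B + 2..s}}"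

text \<open>Cars in \<open>B\<close> prefer spots up to \<open>card B\<close>, all others skip spot
  \<open>card B + 1\<close>. Hence \<open>f\<close> and the size of \<open>B\<close> determine
  \<open>B\<close>.\<close>

lemma overflow_maps_cars:
  assumes "f \<in> overflow_maps A s B" "B \<subseteq> A"
  shows "{a \<in> A. f a \<le> card B + 1} = B"
proof -
  have "f a \<le> card B" if "a \<in> B" for a
    using assms that by (fastforce simp: overflow_maps_def parking_maps_def PiE_iff)
  moreover have "card B + 2 \<le> f a" if "a \<in> A - B" for a
    using assms that by (fastforce simp: overflow_maps_def)
  ultimately show ?thesis
    using \<open>B \<subseteq> A\<close> by fastforce
qed

text \<open>If \<open>C\<close> were larger, its parking condition at spot \<open>card B + 1\<close>
  would require more than \<open>card B\<close> cars there or below, but all such cars lie in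
  \<open>B\<close>.\<close>

lemma overflow_maps_card_mono:
  assumes "finite A" "B \<subseteq> A" "C \<subseteq> A" "f \<in> overflow_maps A s B" "f \<in> overflow_maps A s C"
  shows "card C \<le> card B"
proof (rule ccontr)
  assume "\<not> card C \<le> card B"
  then have "card B + 1 \<in> {1..card C}" by simp
  then have "card B + 1 \<le> card {a \<in> C. restrict f C a \<le> card B + 1}"
    using assms(5) unfolding overflow_maps_def parking_maps_def by blast
  also have "\<dots> \<le> card B"
  proof (rule card_mono)
    show "finite B" by (rule finite_subset[OF assms(2,1)])
    have "{a \<in> C. restrict f C a \<le> card B + 1} \<subseteq> {a \<in> A. f a \<le> card B + 1}"
      using \<open>C \<subseteq> A\<close> by auto
    then show "{a \<in> C. restrict f C a \<le> card B + 1} \<subseteq> B"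
      using overflow_maps_cars[OF assms(4,2)] by simp
  qed
  finally show False by simp
qed

lemma overflow_maps_inj:
  assumes "finite A" "B \<subseteq> A" "C \<subseteq> A" "f \<in> overflow_maps A s B" "f \<in> overflow_maps A s C"
  shows "B = C"
proof -
  have "card B = card C"
    using overflow_maps_card_mono[OF assms(1,2,3,4,5)] overflow_maps_card_mono[OF assms(1,3,2,5,4)]
    by simp
  then show ?thesis
    using overflow_maps_cars[OF assms(4,2)] overflow_maps_cars[OF assms(5,3)] by simp
qed

lemma finite_parking_maps:
  assumes "finite A"
  shows "finite (parking_maps A s)"
proof (rule finite_subset)
  show "parking_maps A s \<subseteq> A \<rightarrow>\<^sub>E {1..s}"
    unfolding parking_maps_def by blast
  show "finite (A \<rightarrow>\<^sub>E {1..s})"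
    using assms by (simp add: finite_PiE)
qed

text \<open>The restrictions of \<open>f\<close> to \<open>B\<close> and to \<open>A - B\<close> can
  be chosen independently.\<close>

lemma card_overflow_maps:
  assumes "finite A" "B \<subseteq> A" "card B < s"
  shows "card (overflow_maps A s B)
    = card (parking_maps B (card B)) * (s - card B - 1) ^ (card A - card B)"
proof -
  let ?R = "(A - B) \<rightarrow>\<^sub>E {card B + 2..s}"
  have "bij_betw (\<lambda>f. (restrict f B, restrict f (A - B))) (overflow_maps A s B)
      (parking_maps B (card B) \<times> ?R)"
  proof (rule bij_betwI[where g = "\<lambda>(g, h) a. if a \<in> B then g a else h a"])
    show "(\<lambda>f. (restrict f B, restrict f (A - B)))
        \<in> overflow_maps A s B \<rightarrow> parking_maps B (card B) \<times> ?R"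
      by (auto simp: overflow_maps_def)
    show "(\<lambda>(g, h) a. if a \<in> B then g a else h a)
        \<in> parking_maps B (card B) \<times> ?R \<rightarrow> overflow_maps A s B"
    proof clarify
      fix g h assume g: "g \<in> parking_maps B (card B)" and h: "h \<in> ?R"
      let ?f = "\<lambda>a. if a \<in> B then g a else h a"
      have g': "g \<in> B \<rightarrow>\<^sub>E {1..card B}"
        using g by (simp add: parking_maps_def)
      have "restrict ?f B = g"
        using g' by (auto simp: fun_eq_iff PiE_iff extensional_def)
      moreover have "?f a \<in> {1..s}" if "a \<in> A" for a
        using PiE_mem[OF g'] PiE_mem[OF h] \<open>card B < s\<close> that by fastforce
      moreover have "?f a = undefined" if "a \<notin> A" for a
        using h \<open>B \<subseteq> A\<close> that by (auto simp: PiE_iff extensional_def)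
      moreover have "?f ` (A - B) \<subseteq> {card B + 2..s}"
        using PiE_mem[OF h] by fastforce
      ultimately show "?f \<in> overflow_maps A s B"
        using g by (auto simp: overflow_maps_def PiE_iff extensional_def)
    qed
    show "(\<lambda>(g, h) a. if a \<in> B then g a else h a) (restrict f B, restrict f (A - B)) = f"
      if "f \<in> overflow_maps A s B" for f
      using that \<open>B \<subseteq> A\<close>
      by (auto simp: overflow_maps_def PiE_iff extensional_def fun_eq_iff)
    show "(\<lambda>f. (restrict f B, restrict f (A - B))) ((\<lambda>(g, h) a. if a \<in> B then g a else h a) p) = p"
      if "p \<in> parking_maps B (card B) \<times> ?R" for p
      using that
      by (auto simp: parking_maps_def PiE_iff extensional_def fun_eq_iff)
  qed
  then have "card (overflow_maps A s B) = card (parking_maps B (card B)) * card ?R"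
    by (simp add: bij_betw_same_card card_cartesian_product)
  \<comment> \<open>For \<open>s = card B + 1\<close> no spot is left; the power is then 0, except
    that \<open>0 ^ 0 = 1\<close> counts the empty map when \<open>B = A\<close>.\<close>
  also have "card ?R = (s - card B - 1) ^ (card A - card B)"
    using assms by (simp add: card_PiE card_Diff_subset finite_subset)
  finally show ?thesis .
qed

lemma funcset_decomposition:
  assumes "finite A"
  shows "A \<rightarrow>\<^sub>E {1..s} = parking_maps A s \<union> (\<Union>B\<in>{B. B \<subseteq> A \<and> card B < s}. overflow_maps A s B)"
    (is "?L = ?R")
proof
  show "?R \<subseteq> ?L"
    unfolding parking_maps_def overflow_maps_def by auto
  show "?L \<subseteq> ?R"
  proof
    fix f assume f: "f \<in> ?L"
    let ?C = "\<lambda>i. {a \<in> A. f a \<le> i}"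
    \<comment> \<open>The parking condition fails at spot \<open>Suc i\<close>; with this shift the
      least such \<open>i\<close> becomes the size of \<open>B\<close>.\<close>
    let ?P = "\<lambda>i. i < s \<and> card (?C (Suc i)) \<le> i"
    show "f \<in> ?R"
    proof (cases "\<exists>i. ?P i")
      case False
      then have "i \<le> card (?C i)" if "i \<in> {1..s}" for i
        using that by (cases i) (auto simp: not_le Suc_le_eq)
      then show ?thesis using f by (simp add: parking_maps_def)
    next
      case True
      define i where "i = (LEAST i. ?P i)"
      define B where "B = ?C i"
      have i: "i < s" "card (?C (Suc i)) \<le> i"
        using LeastI_ex[OF True] by (auto simp: i_def)
      have below: "j \<le> card (?C j)" if "j \<le> i" for j
      proof (cases j)
        case (Suc k)
        then have "\<not> ?P k"
          using that not_less_Least[of k ?P] by (simp add: i_def)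
        then show ?thesis using Suc that i by simp
      qed simp
      \<comment> \<open>At least \<open>i\<close> cars prefer spots up to \<open>i\<close>, and at
        most \<open>i\<close> prefer spots up to \<open>Suc i\<close>. The two sets therefore
        coincide: they have exactly \<open>i\<close> cars, and nobody prefers spot
        \<open>Suc i\<close>.\<close>
      have BC: "B = ?C (Suc i)"
        unfolding B_def
        using assms i below[of i] by (intro card_seteq) auto
      then have cB: "card B = i"
        using i below[of i] by (simp add: B_def)
      have "restrict f B \<in> parking_maps B (card B)"
      proof -
        have "restrict f B a \<in> {1..i}" if "a \<in> B" for a
          using that PiE_mem[OF f] by (auto simp: B_def)
        moreover have "j \<le> card {a \<in> B. restrict f B a \<le> j}" if "j \<in> {1..i}" for j
        proof -
          have "{a \<in> B. restrict f B a \<le> j} = ?C j"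
            using that by (auto simp: B_def)
          then show ?thesis using below that by simp
        qed
        ultimately show ?thesis
          by (simp add: parking_maps_def cB)
      qed
      moreover have "f ` (A - B) \<subseteq> {card B + 2..s}"
        using PiE_mem[OF f] by (subst BC) (auto simp: cB)
      ultimately have "f \<in> overflow_maps A s B"
        using f by (simp add: overflow_maps_def)
      moreover have "B \<subseteq> A" by (auto simp: B_def)
      ultimately show ?thesis using cB i by blast
    qed
  qed
qed

lemma power_card_decomposition:
  assumes "finite A"
  shows "s ^ card A = card (parking_maps A s) + (\<Sum>B | B \<subseteq> A \<and> card B < s.
    card (parking_maps B (card B)) * (s - card B - 1) ^ (card A - card B))"
proof -
  let ?I = "{B. B \<subseteq> A \<and> card B < s}"
  have finE: "finite (A \<rightarrow>\<^sub>E {1..s})"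
    using assms by (simp add: finite_PiE)
  have finO: "finite (overflow_maps A s B)" for B
    by (rule finite_subset[OF _ finE]) (auto simp: overflow_maps_def)
  have disj: "parking_maps A s \<inter> (\<Union>B\<in>?I. overflow_maps A s B) = {}"
  proof -
    \<comment> \<open>A parking map needs \<open>card B + 1\<close> cars at spots up to
      \<open>card B + 1\<close>, where an overflow map has only the cars of
      \<open>B\<close>.\<close>
    have False if "f \<in> parking_maps A s" "B \<subseteq> A" "card B < s" "f \<in> overflow_maps A s B" for f B
    proof -
      have "card B + 1 \<le> card {a \<in> A. f a \<le> card B + 1}"
        using that(1,3) unfolding parking_maps_def by auto
      then show False
        using overflow_maps_cars[OF that(4,2)] by simp
    qed
    then show ?thesis by blast
  qed
  have "s ^ card A = card (A \<rightarrow>\<^sub>E {1..s})"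
    using assms by (simp add: card_PiE)
  also have "\<dots> = card (parking_maps A s) + card (\<Union>B\<in>?I. overflow_maps A s B)"
    unfolding funcset_decomposition[OF assms]
    using assms finO disj by (intro card_Un_disjoint finite_parking_maps) auto
  also have "card (\<Union>B\<in>?I. overflow_maps A s B) = (\<Sum>B\<in>?I. card (overflow_maps A s B))"
  proof (rule card_UN_disjoint)
    show "finite ?I" using assms by simp
    show "\<forall>B\<in>?I. finite (overflow_maps A s B)" using finO by blast
    show "\<forall>B\<in>?I. \<forall>C\<in>?I. B \<noteq> C \<longrightarrow> overflow_maps A s B \<inter> overflow_maps A s C = {}"
      using overflow_maps_inj[OF assms] by blast
  qed
  also have "\<dots> = (\<Sum>B\<in>?I. card (parking_maps B (card B)) * (s - card B - 1) ^ (card A - card B))"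
    using card_overflow_maps[OF assms] by (intro sum.cong) auto
  finally show ?thesis .
qed

section \<open>Solving the recursion by Abel's identity\<close>

text \<open>There are fewer cars than spots. Thus the decomposition with
  \<open>s = card A + 1\<close> consists of overflow terms only.\<close>

lemma parking_maps_Suc_card:
  assumes "finite A"
  shows "parking_maps A (Suc (card A)) = {}"
proof -
  have "\<not> Suc (card A) \<le> card {a \<in> A. f a \<le> Suc (card A)}" for f :: "'a \<Rightarrow> nat"
    using card_mono[OF assms, of "{a \<in> A. f a \<le> Suc (card A)}"] by simp
  moreover have "Suc (card A) \<in> {1..Suc (card A)}" by simp
  ultimately show ?thesis
    unfolding parking_maps_def by blast
qed

lemma card_parking_maps_card:
  assumes "finite A"
  shows "card (parking_maps A (card A)) = (card A + 1) ^ (card A - 1)"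
  using assms
proof (induction A rule: finite_psubset_induct)
  case (psubset A)
  let ?n = "card A"
  let ?g = "\<lambda>i. (i + 1) ^ (i - 1) * (?n - i) ^ (?n - i)"
  have fin: "finite {B. B \<subseteq> A \<and> card B < ?n}" using psubset.hyps by simp
  \<comment> \<open>The subset \<open>A\<close> itself contributes the unknown count, with factor
    \<open>0 ^ 0 = 1\<close>; the induction hypothesis covers the proper subsets.\<close>
  have idx: "{B. B \<subseteq> A \<and> card B < Suc ?n} = insert A {B. B \<subseteq> A \<and> card B < ?n}"
    using card_subset_eq[OF psubset.hyps] by (auto simp: less_Suc_eq)
  have "(?n + 1) ^ ?n = (\<Sum>B | B \<subseteq> A \<and> card B < Suc ?n.
      card (parking_maps B (card B)) * (?n - card B) ^ (?n - card B))"
    using power_card_decomposition[OF psubset.hyps, of "Suc ?n"] parking_maps_Suc_card[OF psubset.hyps]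
    by simp
  also have "\<dots> = card (parking_maps A ?n) + (\<Sum>B | B \<subseteq> A \<and> card B < ?n.
      card (parking_maps B (card B)) * (?n - card B) ^ (?n - card B))"
    unfolding idx using fin by simp
  also have "(\<Sum>B | B \<subseteq> A \<and> card B < ?n. card (parking_maps B (card B)) * (?n - card B) ^ (?n - card B))
      = (\<Sum>B | B \<subseteq> A \<and> card B < ?n. ?g (card B))"
  proof (rule sum.cong[OF refl])
    fix B assume "B \<in> {B. B \<subseteq> A \<and> card B < ?n}"
    then have "B \<subset> A" by auto
    then show "card (parking_maps B (card B)) * (?n - card B) ^ (?n - card B) = ?g (card B)"
      using psubset.IH by simp
  qed
  also have "\<dots> = (\<Sum>i<?n. (?n choose i) * ?g i)"
    by (rule sum_subsets_by_card[OF psubset.hyps])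
  finally have rec: "(?n + 1) ^ ?n = card (parking_maps A ?n) + (\<Sum>i<?n. (?n choose i) * ?g i)" .
  have "int ((?n + 1) ^ ?n) = int (?n + 1) ^ ?n" by simp
  also have "\<dots> = (\<Sum>i\<le>?n. int (?n choose i) * (int i + 1) ^ (i - 1) *
      (int (?n + 1) - int i - 1) ^ (?n - i))"
    by (rule Abel_identity[symmetric])
  also have "\<dots> = int (\<Sum>i\<le>?n. (?n choose i) * ?g i)"
    unfolding of_nat_sum by (intro sum.cong refl) (simp add: of_nat_diff add.commute)
  finally have "(?n + 1) ^ ?n = (\<Sum>i\<le>?n. (?n choose i) * ?g i)"
    by (simp only: of_nat_eq_iff)
  also have "\<dots> = (\<Sum>i<?n. (?n choose i) * ?g i) + (?n + 1) ^ (?n - 1)"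
    unfolding lessThan_Suc_atMost[symmetric] sum.lessThan_Suc by simp
  finally show ?case using rec by linarith
qed

lemma card_parking_maps:
  assumes "finite A" "s \<le> card A"
  shows "int (card (parking_maps A s)) = (\<Sum>i=s..card A. int (card A choose i) *
    (int i + 1) ^ (i - 1) * (int s - int i - 1) ^ (card A - i))"
proof -
  let ?n = "card A"
  let ?t = "\<lambda>i. int (?n choose i) * (int i + 1) ^ (i - 1) * (int s - int i - 1) ^ (?n - i)"
  let ?g = "\<lambda>i. (i + 1) ^ (i - 1) * (s - i - 1) ^ (?n - i)"
  have "s ^ ?n = card (parking_maps A s) + (\<Sum>B | B \<subseteq> A \<and> card B < s. ?g (card B))"
  proof -
    have "card (parking_maps B (card B)) = (card B + 1) ^ (card B - 1)" if "B \<subseteq> A" for B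
      using that assms(1) by (intro card_parking_maps_card) (rule finite_subset)
    then have "(\<Sum>B | B \<subseteq> A \<and> card B < s.
        card (parking_maps B (card B)) * (s - card B - 1) ^ (?n - card B))
      = (\<Sum>B | B \<subseteq> A \<and> card B < s. ?g (card B))"
      by (intro sum.cong) auto
    then show ?thesis
      using power_card_decomposition[OF assms(1), of s] by simp
  qed
  also have "(\<Sum>B | B \<subseteq> A \<and> card B < s. ?g (card B)) = (\<Sum>i<s. (?n choose i) * ?g i)"
    by (rule sum_subsets_by_card[OF assms(1)])
  finally have "int (s ^ ?n) = int (card (parking_maps A s) + (\<Sum>i<s. (?n choose i) * ?g i))"
    by (rule arg_cong)
  then have "int s ^ ?n = int (card (parking_maps A s)) + (\<Sum>i<s. int ((?n choose i) * ?g i))"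
    by (simp only: of_nat_add of_nat_power of_nat_sum)
  \<comment> \<open>For \<open>i < s\<close> the truncated difference \<open>s - i - 1\<close>
    agrees with the integer one. The terms with \<open>i \<ge> s\<close>, whose bases are negative,
    enter only through Abel's identity over the integers.\<close>
  also have "(\<Sum>i<s. int ((?n choose i) * ?g i)) = (\<Sum>i<s. ?t i)"
    by (intro sum.cong) (auto simp: of_nat_diff add.commute algebra_simps)
  finally have "int (card (parking_maps A s)) = int s ^ ?n - (\<Sum>i<s. ?t i)" by simp
  also have "int s ^ ?n = (\<Sum>i\<le>?n. ?t i)"
    using Abel_identity[of ?n "int s"] by simp
  also have "{..?n} = {..<s} \<union> {s..?n}" using assms by auto
  also have "(\<Sum>i\<in>{..<s} \<union> {s..?n}. ?t i) = (\<Sum>i<s. ?t i) + (\<Sum>i=s..?n. ?t i)"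
    by (intro sum.union_disjoint) auto
  finally show ?thesis by simp
qed

section \<open>Return to restricted parking functions\<close>

text \<open>The conditions for \<open>i > s\<close> hold automatically: all \<open>n\<close> cars
  prefer spots up to \<open>s\<close>, and \<open>n \<ge> i\<close>.\<close>

lemma restricted_PF_eq_parking_maps:
  assumes "s \<le> n"
  shows "restricted_PF n {1..s} = parking_maps {1..n} s"
proof -
  have "(\<forall>i\<in>{1..n}. i \<le> card (\<pi> -` {1..i} \<inter> {1..n}))
      \<longleftrightarrow> (\<forall>i\<in>{1..s}. i \<le> card {a \<in> {1..n}. \<pi> a \<le> i})"
    if \<pi>: "\<pi> \<in> {1..n} \<rightarrow>\<^sub>E {1..s}" for \<pi>
  proof -
    have range: "1 \<le> \<pi> a \<and> \<pi> a \<le> s" if "a \<in> {1..n}" for a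
      using PiE_mem[OF \<pi> that] by simp
    have eq: "\<pi> -` {1..i} \<inter> {1..n} = {a \<in> {1..n}. \<pi> a \<le> i}" for i
      using range by auto
    have "i \<le> card {a \<in> {1..n}. \<pi> a \<le> i}" if "i \<in> {1..n}" "i \<notin> {1..s}" for i
    proof -
      have "\<pi> a \<le> i" if "a \<in> {1..n}" for a
        using range[OF that] \<open>i \<in> {1..n}\<close> \<open>i \<notin> {1..s}\<close> by simp
      then have "{a \<in> {1..n}. \<pi> a \<le> i} = {1..n}" by blast
      then show ?thesis using \<open>i \<in> {1..n}\<close> by simp
    qed
    moreover have "{1..s} \<subseteq> {1..n}" using assms by simp
    ultimately show ?thesis unfolding eq by blast
  qed
  moreover have "\<pi> \<in> {1..n} \<rightarrow>\<^sub>E {1..n} \<and> \<pi> ` {1..n} \<subseteq> {1..s} \<longleftrightarrow> \<pi> \<in> {1..n} \<rightarrow>\<^sub>E {1..s}" for \<pi>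
  proof -
    have "{1..s} \<subseteq> {1..n}" using assms by simp
    then show ?thesis unfolding PiE_iff image_subset_iff by blast
  qed
  ultimately show ?thesis
    unfolding restricted_PF_def parking_function_def parking_maps_def by blast
qed

theorem theorem8:
  fixes s n :: nat
  assumes "1 \<le> s" and "s \<le> n"
  shows "int (card (restricted_PF n {1..s})) =
    (\<Sum>i=s..n. int (n choose i) * (int i + 1) ^ (i - 1) * (int s - int i - 1) ^ (n - i))"
  unfolding restricted_PF_eq_parking_maps[OF assms(2)]
  using card_parking_maps[of "{1..n}" s] assms(2) by simp

end
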